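(* Let $T=S_1\otimes S_3\otimes S_0+S_2\otimes S_0\otimes S_1+S_3\otimes S_2\otimes S_1+S_1\otimes S_2\otimes S_2+S_2\otimes S_1\otimes S_3+S_3\otimes S_3\otimes S_3$ and $$U_8=S_0\otimes S_0\otimes S_0+S_1\otimes S_3\otimes S_0+S_2\otimes S_0\otimes S_1+S_3\otimes S_2\otimes S_1+S_0\otimes S_1\otimes S_2+S_1\otimes S_2\otimes S_2+S_2\otimes S_1\otimes S_3+S_3\otimes S_3\otimes S_3.$$ Then $\mathrm{sr}(T)=6$ and $\mathrm{sr}(U_8)\ge 6$.
   Context: $S_0=\begin{bmatrix}1&0\\0&0\end{bmatrix}$, $S_1=\begin{bmatrix}0&1\\0&0\end{bmatrix}$, $S_2=\begin{bmatrix}0&0\\1&0\end{bmatrix}$, $S_3=\begin{bmatrix}0&0\\0&1\end{bmatrix}$. For a matrix $U$ on $\mathbb{C}^2\otimes\mathbb{C}^2\otimes\mathbb{C}^2$ (systems $A,B,C$), its Schmidt rank $\mathrm{sr}(U)$ is the least integer $r$ such that $U=\sum_{j=1}^r A_j\otimes B_j\otimes C_j$ with $A_j,B_j,C_j$ complex $2\times 2$ matrices (i.e. the tensor rank of $U$). *)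

theory Defs
  imports "HOL-Analysis.Analysis"
begin

type_synonym mat2 = "complex^2^2"
type_synonym mat8 = "complex^(2 \<times> 2 \<times> 2)^(2 \<times> 2 \<times> 2)"

text \<open>Matrix units; rows/columns of a 2x2 matrix are indexed by 1, 2 :: 2.\<close>
definition S0 :: mat2 where "S0 = (\<chi> i j. if i = 1 \<and> j = 1 then 1 else 0)"
definition S1 :: mat2 where "S1 = (\<chi> i j. if i = 1 \<and> j = 2 then 1 else 0)"
definition S2 :: mat2 where "S2 = (\<chi> i j. if i = 2 \<and> j = 1 then 1 else 0)"
definition S3 :: mat2 where "S3 = (\<chi> i j. if i = 2 \<and> j = 2 then 1 else 0)"

text \<open>Kronecker product A (x) B (x) C acting on C^2 (x) C^2 (x) C^2 (systems A,B,C).\<close>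
definition tensor3 :: "mat2 \<Rightarrow> mat2 \<Rightarrow> mat2 \<Rightarrow> mat8" where
  "tensor3 A B C = (\<chi> r c. A$(fst r)$(fst c) * B$(fst (snd r))$(fst (snd c)) * C$(snd (snd r))$(snd (snd c)))"

text \<open>Schmidt rank = tensor rank.\<close>
definition schmidt_rank :: "mat8 \<Rightarrow> nat" where
  "schmidt_rank U = (LEAST r. \<exists>A B C :: nat \<Rightarrow> mat2.
      U = (\<Sum>j<r. tensor3 (A j) (B j) (C j)))"

definition T_op :: mat8 where
  "T_op = tensor3 S1 S3 S0 + tensor3 S2 S0 S1 + tensor3 S3 S2 S1
        + tensor3 S1 S2 S2 + tensor3 S2 S1 S3 + tensor3 S3 S3 S3"

definition U8 :: mat8 where
  "U8 = tensor3 S0 S0 S0 + tensor3 S1 S3 S0 + tensor3 S2 S0 S1 + tensor3 S3 S2 S1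
      + tensor3 S0 S1 S2 + tensor3 S1 S2 S2 + tensor3 S2 S1 S3 + tensor3 S3 S3 S3"

end

theory Submission
  imports Defs
begin

(*
  Lower bounds come from Koszul flattenings.  View a tensor t as an element of
  C^3 \<otimes> B \<otimes> C and map e \<otimes> \<beta> to (e \<and> t(\<beta>)) in \<Lambda>^2 C^3 \<otimes> C.  For a rank-one
  tensor a \<otimes> b \<otimes> c this map factors through e \<mapsto> a \<and> e, which has rank at most 2
  on C^3; hence a tensor of rank r has Koszul flattenings of rank at most 2r.

  Operators on C^2 \<otimes> C^2 \<otimes> C^2 are read as tensors in C^4 \<otimes> C^4 \<otimes> C^4 through
  their coefficients on S_a \<otimes> S_b \<otimes> S_c.  For U_8, merging S_1 and S_2 in the first
  factor gives a tensor in C^3 \<otimes> C^4 \<otimes> C^4 whose 12 x 12 Koszul flattening is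
  invertible, so 12 \<le> 2r.  For T, two steps of the substitution method each remove
  one term of a decomposition; what remains, with the B-factor cut down to
  S_1, S_2, S_3, has an invertible 7 x 7 Koszul minor, so 7 \<le> 2(r - 2).  The six
  defining terms of T give the matching upper bound.
*)

lemma sum_lessThan_3: "(\<Sum>x<3::nat. f x) = f 0 + f 1 + (f 2 :: 'a::comm_monoid_add)"
  by (simp add: eval_nat_numeral add_ac)

(* wedge_coeff p x x' is the coefficient of the p-th basis bivector
  e_0\<and>e_1, e_0\<and>e_2, e_1\<and>e_2 of \<Lambda>^2 C^3 in e_x \<and> e_x', so wedge_with al p x' is
  the p-th coordinate of al \<and> e_x'. *)
definition wedge_coeff :: "nat \<Rightarrow> nat \<Rightarrow> nat \<Rightarrow> complex" where
  "wedge_coeff p x x' =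
     (if (p, x, x') \<in> {(0, 0, 1), (1, 0, 2), (2, 1, 2)} then 1
      else if (p, x', x) \<in> {(0, 0, 1), (1, 0, 2), (2, 1, 2)} then -1 else 0)"

definition wedge_with :: "(nat \<Rightarrow> complex) \<Rightarrow> nat \<Rightarrow> nat \<Rightarrow> complex" where
  "wedge_with al p x' = (\<Sum>x<3. wedge_coeff p x x' * al x)"

lemma wedge_with_eq:
  "wedge_with al p x' =
     (if p = 0 then (if x' = 1 then al 0 else if x' = 0 then - al 1 else 0)
      else if p = 1 then (if x' = 2 then al 0 else if x' = 0 then - al 2 else 0)
      else if p = 2 then (if x' = 2 then al 1 else if x' = 1 then - al 2 else 0) else 0)"
  by (simp add: wedge_with_def wedge_coeff_def sum_lessThan_3)

lemma wedge_with_range_two_span: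
  "\<exists>s1 s2 :: nat \<Rightarrow> complex. \<forall>x'. \<exists>a b. \<forall>p. wedge_with al p x' = a * s1 p + b * s2 p"
proof (cases "al 0 \<noteq> 0")
  case True
  define s1 where "s1 p = (if p = 0 then 1 else if p = 2 then - al 2 / al 0 else 0)" for p :: nat
  define s2 where "s2 p = (if p = 1 then 1 else if p = 2 then al 1 / al 0 else 0)" for p :: nat
  have "wedge_with al p x' = wedge_with al 0 x' * s1 p + wedge_with al 1 x' * s2 p" for p x'
    using True by (simp add: wedge_with_eq s1_def s2_def field_simps)
  then show ?thesis by blast
next
  case al0: False
  show ?thesis
  proof (cases "al 1 \<noteq> 0")
    case True
    define s1 where "s1 p = (if p = 0 then 1 else if p = 1 then al 2 / al 1 else 0)" for p :: nat
    define s2 where "s2 p = (if p = 2 then 1 else 0 :: complex)" for p :: nat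
    have "wedge_with al p x' = wedge_with al 0 x' * s1 p + wedge_with al 2 x' * s2 p" for p x'
      using True al0 by (simp add: wedge_with_eq s1_def s2_def field_simps)
    then show ?thesis by blast
  next
    case False
    define s1 where "s1 p = (if p = 1 then 1 else 0 :: complex)" for p :: nat
    define s2 where "s2 p = (if p = 2 then 1 else 0 :: complex)" for p :: nat
    have "wedge_with al p x' = wedge_with al 1 x' * s1 p + wedge_with al 2 x' * s2 p" for p x'
      using False al0 by (simp add: wedge_with_eq s1_def s2_def)
    then show ?thesis by blast
  qed
qed

(* A minor of the Koszul flattening C^3 \<otimes> B^* \<rightarrow> \<Lambda>^2 C^3 \<otimes> C of t; row r is
  the basis element indexed by \<rho> r = (bivector, C-index), column c the one indexed
  by \<kappa> c = (C^3-index, B-index). *)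
definition koszul_flattening ::
    "(nat \<Rightarrow> 'y \<Rightarrow> 'z \<Rightarrow> complex) \<Rightarrow> ('m \<Rightarrow> nat \<times> 'z) \<Rightarrow> ('n \<Rightarrow> nat \<times> 'y) \<Rightarrow> complex^'n^'m" where
  "koszul_flattening t \<rho> \<kappa> =
     (\<chi> r c. \<Sum>x<3. wedge_coeff (fst (\<rho> r)) x (fst (\<kappa> c)) * t x (snd (\<kappa> c)) (snd (\<rho> r)))"

lemma koszul_flattening_rank_one_range:
  fixes \<rho> :: "'m::finite \<Rightarrow> nat \<times> 'z" and \<kappa> :: "'n::finite \<Rightarrow> nat \<times> 'y"
  shows "\<exists>P Q. range ((*v) (koszul_flattening (\<lambda>x y z. al x * be y * ga z) \<rho> \<kappa>)) \<subseteq> vec.span {P, Q}"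
proof -
  obtain s1 s2 a b where ab: "\<And>x' p. wedge_with al p x' = a x' * s1 p + b x' * s2 p"
    using wedge_with_range_two_span[of al] by metis
  define P :: "complex^'m" where "P = (\<chi> r. ga (snd (\<rho> r)) * s1 (fst (\<rho> r)))"
  define Q :: "complex^'m" where "Q = (\<chi> r. ga (snd (\<rho> r)) * s2 (fst (\<rho> r)))"
  have "koszul_flattening (\<lambda>x y z. al x * be y * ga z) \<rho> \<kappa> *v u \<in> vec.span {P, Q}" for u
  proof -
    define A where "A = (\<Sum>c\<in>UNIV. a (fst (\<kappa> c)) * be (snd (\<kappa> c)) * u $ c)"
    define B where "B = (\<Sum>c\<in>UNIV. b (fst (\<kappa> c)) * be (snd (\<kappa> c)) * u $ c)"
    have wedge: "(\<Sum>x<3. wedge_coeff p x x' * (al x * y * z)) = wedge_with al p x' * y * z" for p x' y z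
      by (simp add: wedge_with_def sum_lessThan_3 algebra_simps)
    have "(koszul_flattening (\<lambda>x y z. al x * be y * ga z) \<rho> \<kappa> *v u) $ r = (A *s P + B *s Q) $ r"
      for r
    proof -
      have "(koszul_flattening (\<lambda>x y z. al x * be y * ga z) \<rho> \<kappa> *v u) $ r =
              (\<Sum>c\<in>UNIV. (a (fst (\<kappa> c)) * s1 (fst (\<rho> r)) + b (fst (\<kappa> c)) * s2 (fst (\<rho> r)))
                         * be (snd (\<kappa> c)) * ga (snd (\<rho> r)) * u $ c)"
        by (simp add: koszul_flattening_def matrix_vector_mult_def wedge ab)
      also have "\<dots> = ga (snd (\<rho> r)) * s1 (fst (\<rho> r)) * A + ga (snd (\<rho> r)) * s2 (fst (\<rho> r)) * B"
        unfolding A_def B_def sum_distrib_left sum.distrib[symmetric]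
        by (rule sum.cong) (simp_all add: algebra_simps)
      finally show ?thesis
        by (simp add: P_def Q_def mult_ac)
    qed
    then have "koszul_flattening (\<lambda>x y z. al x * be y * ga z) \<rho> \<kappa> *v u = A *s P + B *s Q"
      by (simp add: vec_eq_iff)
    also have "\<dots> \<in> vec.span {P, Q}"
      by (intro vec.span_add vec.span_scale vec.span_base) auto
    finally show ?thesis .
  qed
  then show ?thesis by blast
qed

lemma koszul_flattening_sum:
  assumes "\<And>x y z. x < 3 \<Longrightarrow> t x y z = (\<Sum>j\<in>J. al j x * be j y * ga j z)"
  shows "koszul_flattening t \<rho> \<kappa> *v u =
           (\<Sum>j\<in>J. koszul_flattening (\<lambda>x y z. al j x * be j y * ga j z) \<rho> \<kappa> *v u)"
proof -
  have "(\<Sum>x<3. wedge_coeff p x x' * t x y z) =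
          (\<Sum>x<3. wedge_coeff p x x' * (\<Sum>j\<in>J. al j x * be j y * ga j z))" for p x' y z
    using assms by (intro sum.cong) auto
  then show ?thesis
    by (simp add: vec_eq_iff koszul_flattening_def matrix_vector_mult_def sum_component
        sum_distrib_left sum_distrib_right sum.swap[of _ J])
qed

lemma surj_koszul_flattening_card_le:
  fixes \<rho> :: "'m::finite \<Rightarrow> nat \<times> 'z" and \<kappa> :: "'n::finite \<Rightarrow> nat \<times> 'y"
  assumes "finite J"
    and dec: "\<And>x y z. x < 3 \<Longrightarrow> t x y z = (\<Sum>j\<in>J. al j x * be j y * ga j z)"
    and "surj ((*v) (koszul_flattening t \<rho> \<kappa>))"
  shows "CARD('m) \<le> 2 * card J"
proof -
  have "\<forall>j. \<exists>P Q. range ((*v) (koszul_flattening (\<lambda>x y z. al j x * be j y * ga j z) \<rho> \<kappa>))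
                  \<subseteq> vec.span {P, Q}"
    using koszul_flattening_rank_one_range by blast
  then obtain P Q where PQ: "\<And>j. range ((*v) (koszul_flattening (\<lambda>x y z. al j x * be j y * ga j z) \<rho> \<kappa>))
                              \<subseteq> vec.span {P j, Q j}"
    by metis
  define W where "W = (\<Union>j\<in>J. {P j, Q j})"
  have "range ((*v) (koszul_flattening t \<rho> \<kappa>)) \<subseteq> vec.span W"
  proof (rule image_subsetI)
    fix u
    have "koszul_flattening t \<rho> \<kappa> *v u =
            (\<Sum>j\<in>J. koszul_flattening (\<lambda>x y z. al j x * be j y * ga j z) \<rho> \<kappa> *v u)"
      using dec by (rule koszul_flattening_sum)
    also have "\<dots> \<in> vec.span W"
    proof (rule vec.span_sum)
      fix j assume "j \<in> J"
      then have "vec.span {P j, Q j} \<subseteq> vec.span W"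
        by (intro vec.span_mono) (auto simp: W_def)
      then show "koszul_flattening (\<lambda>x y z. al j x * be j y * ga j z) \<rho> \<kappa> *v u \<in> vec.span W"
        using PQ by blast
    qed
    finally show "koszul_flattening t \<rho> \<kappa> *v u \<in> vec.span W" .
  qed
  moreover have "range ((*v) (koszul_flattening t \<rho> \<kappa>)) = UNIV"
    using assms(3) by simp
  moreover have "finite W"
    using assms(1) by (simp add: W_def)
  ultimately have "vec.dim (UNIV :: (complex^'m) set) \<le> card W"
    using vec.dim_le_card by metis
  then have "CARD('m) \<le> card W"
    by (simp only: vec_dim_card)
  also have "card W \<le> (\<Sum>j\<in>J. card {P j, Q j})"
    unfolding W_def using assms(1) by (rule card_UN_le)
  also have "\<dots> \<le> (\<Sum>j\<in>J. 2)"
    by (intro sum_mono) (simp add: card_insert_le_m1)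
  also have "\<dots> = 2 * card J"
    by simp
  finally show ?thesis .
qed

lemma substitution_third_factor:
  fixes t :: "'x \<Rightarrow> 'y \<Rightarrow> 'z \<Rightarrow> complex"
  assumes "finite J"
    and dec: "\<And>x y z. t x y z = (\<Sum>j\<in>J. al j x * be j y * ga j z)"
    and "t a b c \<noteq> 0"
  obtains j0 k ga' where "j0 \<in> J"
    and "\<And>x y z. t x y z - k z * t x y c = (\<Sum>j\<in>J - {j0}. al j x * be j y * ga' j z)"
proof -
  have "(\<Sum>j\<in>J. al j a * be j b * ga j c) \<noteq> 0"
    using assms(3) by (simp add: dec)
  then obtain j0 where "j0 \<in> J" and "al j0 a * be j0 b * ga j0 c \<noteq> 0"
    by (rule sum.not_neutral_contains_not_neutral)
  then have nz: "ga j0 c \<noteq> 0" by simp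
  define k where "k z = ga j0 z / ga j0 c" for z
  define ga' where "ga' j z = ga j z - ga j c * k z" for j z
  have "t x y z - k z * t x y c = (\<Sum>j\<in>J - {j0}. al j x * be j y * ga' j z)" for x y z
  proof -
    have "t x y z - k z * t x y c = (\<Sum>j\<in>J. al j x * be j y * ga' j z)"
      by (simp add: dec ga'_def sum_subtractf sum_distrib_left algebra_simps)
    also have "\<dots> = (\<Sum>j\<in>J - {j0}. al j x * be j y * ga' j z)"
      using nz by (intro sum.mono_neutral_right) (auto simp: assms(1) ga'_def k_def)
    finally show ?thesis .
  qed
  with \<open>j0 \<in> J\<close> show ?thesis
    using that by blast
qed

lemma schmidt_rank_le:
  fixes A B C :: "nat \<Rightarrow> mat2" and r :: nat
  assumes "U = (\<Sum>j<r. tensor3 (A j) (B j) (C j))"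
  shows "schmidt_rank U \<le> r"
  unfolding schmidt_rank_def using assms by (intro Least_le) blast

lemma schmidt_rank_attained:
  fixes A B C :: "nat \<Rightarrow> mat2" and r :: nat
  assumes "U = (\<Sum>j<r. tensor3 (A j) (B j) (C j))"
  obtains A' B' C' where "U = (\<Sum>j<schmidt_rank U. tensor3 (A' j) (B' j) (C' j))"
proof -
  have "\<exists>r. \<exists>A B C :: nat \<Rightarrow> mat2. U = (\<Sum>j<r. tensor3 (A j) (B j) (C j))"
    using assms by blast
  then have "\<exists>A B C :: nat \<Rightarrow> mat2. U = (\<Sum>j<schmidt_rank U. tensor3 (A j) (B j) (C j))"
    unfolding schmidt_rank_def by (rule LeastI_ex)
  then show ?thesis
    using that by blast
qed

(* S_k is the matrix unit at position (unit_row k, unit_col k), so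
  coeff3 U a b c is the coefficient of S_a \<otimes> S_b \<otimes> S_c in U. *)
definition unit_row :: "nat \<Rightarrow> 2" where "unit_row k = (if k < 2 then 1 else 2)"
definition unit_col :: "nat \<Rightarrow> 2" where "unit_col k = (if even k then 1 else 2)"

definition unit_coeff :: "nat \<Rightarrow> mat2 \<Rightarrow> complex" where
  "unit_coeff k M = M $ unit_row k $ unit_col k"

definition coeff3 :: "mat8 \<Rightarrow> nat \<Rightarrow> nat \<Rightarrow> nat \<Rightarrow> complex" where
  "coeff3 U a b c = U $ (unit_row a, unit_row b, unit_row c) $ (unit_col a, unit_col b, unit_col c)"

lemma coeff3_sum_tensor3:
  "coeff3 (\<Sum>j\<in>J. tensor3 (A j) (B j) (C j)) a b c =
     (\<Sum>j\<in>J. unit_coeff a (A j) * unit_coeff b (B j) * unit_coeff c (C j))"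
  by (simp add: coeff3_def unit_coeff_def sum_component tensor3_def)

lemma less_4_cases: "k < 4 \<Longrightarrow> k = 0 \<or> k = 1 \<or> k = 2 \<or> k = (3::nat)"
  by auto

lemma coeff3_T_op:
  assumes "a < 4" "b < 4" "c < 4"
  shows "coeff3 T_op a b c =
           (if (a, b, c) \<in> {(1, 3, 0), (2, 0, 1), (3, 2, 1), (1, 2, 2), (2, 1, 3), (3, 3, 3)} then 1 else 0)"
  using less_4_cases[OF assms(1)] less_4_cases[OF assms(2)] less_4_cases[OF assms(3)]
  by (elim disjE)
    (simp_all add: coeff3_def T_op_def tensor3_def S0_def S1_def S2_def S3_def unit_row_def unit_col_def)

lemma coeff3_U8:
  assumes "a < 4" "b < 4" "c < 4"
  shows "coeff3 U8 a b c =
           (if (a, b, c) \<in> {(0, 0, 0), (1, 3, 0), (2, 0, 1), (3, 2, 1), (0, 1, 2), (1, 2, 2), (2, 1, 3), (3, 3, 3)}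
            then 1 else 0)"
  using less_4_cases[OF assms(1)] less_4_cases[OF assms(2)] less_4_cases[OF assms(3)]
  by (elim disjE)
    (simp_all add: coeff3_def U8_def tensor3_def S0_def S1_def S2_def S3_def unit_row_def unit_col_def)

lemma exhaust_7:
  fixes i :: 7
  shows "i = 0 \<or> i = 1 \<or> i = 2 \<or> i = 3 \<or> i = 4 \<or> i = 5 \<or> i = 6"
proof (induct i)
  case (of_int z)
  then have "z = 0 \<or> z = 1 \<or> z = 2 \<or> z = 3 \<or> z = 4 \<or> z = 5 \<or> z = 6"
    by fastforce
  then show ?case by auto
qed

lemma sum_UNIV_7:
  "(\<Sum>i\<in>UNIV. f i) = f 0 + (f 1 + (f 2 + (f 3 + (f 4 + (f 5 + (f (6::7) :: 'a::comm_monoid_add))))))"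
proof -
  have univ: "(UNIV :: 7 set) = set [0, 1, 2, 3, 4, 5, 6]"
    using exhaust_7 by auto
  have "distinct [0, 1, 2, 3, 4, 5, 6 :: 7]"
    by simp
  then show ?thesis
    unfolding univ sum.distinct_set_conv_list by simp
qed

(* The coefficients of T_op after the two substitution steps of
  T_op_rank_lower, with multipliers l (third factor) and m (second factor). *)
definition T_op_residual ::
    "(nat \<Rightarrow> complex) \<Rightarrow> (nat \<Rightarrow> complex) \<Rightarrow> nat \<Rightarrow> nat \<Rightarrow> nat \<Rightarrow> complex" where
  "T_op_residual l m a b c =
     coeff3 T_op a b c - l c * coeff3 T_op a b 0 - m b * (coeff3 T_op a 0 c - l c * coeff3 T_op a 0 0)"

definition T_koszul_row :: "7 \<Rightarrow> nat \<times> nat" where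
  "T_koszul_row i = (if i = 0 then (0, 0) else if i = 1 then (0, 1) else if i = 2 then (0, 2)
     else if i = 3 then (1, 2) else if i = 4 then (2, 0) else if i = 5 then (2, 1) else (2, 2))"

definition T_koszul_col :: "7 \<Rightarrow> nat \<times> nat" where
  "T_koszul_col i = (if i = 0 then (0, 0) else if i = 1 then (0, 2) else if i = 2 then (1, 1)
     else if i = 3 then (1, 2) else if i = 4 then (2, 0) else if i = 5 then (2, 1) else (2, 2))"

lemma T_koszul_row_simps:
  "T_koszul_row 0 = (0, 0)" "T_koszul_row 1 = (0, 1)" "T_koszul_row 2 = (0, 2)" "T_koszul_row 3 = (1, 2)"
  "T_koszul_row 4 = (2, 0)" "T_koszul_row 5 = (2, 1)" "T_koszul_row 6 = (2, 2)"
  by (simp_all add: T_koszul_row_def)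

lemma T_koszul_col_simps:
  "T_koszul_col 0 = (0, 0)" "T_koszul_col 1 = (0, 2)" "T_koszul_col 2 = (1, 1)" "T_koszul_col 3 = (1, 2)"
  "T_koszul_col 4 = (2, 0)" "T_koszul_col 5 = (2, 1)" "T_koszul_col 6 = (2, 2)"
  by (simp_all add: T_koszul_col_def)

(* The second factor restricted to S_1, S_2, S_3 plays the role of C^3; the
  minor is invertible for all multipliers l and m. *)
lemma T_op_residual_koszul_surj:
  "surj ((*v) (koszul_flattening (\<lambda>x y z. T_op_residual l m (y + 1) (x + 1) (z + 1)) T_koszul_row T_koszul_col))"
proof (rule surjI)
  fix v :: "complex^7"
  define w where "w = v$3 + l 3 * v$1 - v$0 - m 1 * v$2"
  define u :: "complex^7" where
    "u = (\<chi> c. if c = 0 then - v$1 else if c = 1 then - v$0 - m 1 * v$2 else if c = 2 then v$2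
      else if c = 3 then - v$6 else if c = 4 then v$5 else if c = 5 then w else v$4 - m 3 * v$2 + m 2 * w)"
  have u: "u$0 = - v$1" "u$1 = - v$0 - m 1 * v$2" "u$2 = v$2" "u$3 = - v$6" "u$4 = v$5" "u$5 = w"
    "u$6 = v$4 - m 3 * v$2 + m 2 * w"
    by (simp_all add: u_def)
  have "(koszul_flattening (\<lambda>x y z. T_op_residual l m (y + 1) (x + 1) (z + 1)) T_koszul_row T_koszul_col *v u)$i = v$i"
    for i
    using exhaust_7[of i]
    by (elim disjE) (simp only: matrix_vector_mult_def koszul_flattening_def vec_lambda_beta sum_UNIV_7
        sum_lessThan_3 T_koszul_row_simps T_koszul_col_simps fst_conv snd_conv u;
        simp add: wedge_coeff_def T_op_residual_def coeff3_T_op w_def eval_nat_numeral algebra_simps)+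
  then show "koszul_flattening (\<lambda>x y z. T_op_residual l m (y + 1) (x + 1) (z + 1)) T_koszul_row T_koszul_col *v u = v"
    by (simp add: vec_eq_iff)
qed

lemma T_op_rank_lower:
  fixes A B C :: "nat \<Rightarrow> mat2" and r :: nat
  assumes "T_op = (\<Sum>j<r. tensor3 (A j) (B j) (C j))"
  shows "6 \<le> r"
proof -
  define al where "al j a = unit_coeff a (A j)" for j a
  define be where "be j b = unit_coeff b (B j)" for j b
  define ga where "ga j c = unit_coeff c (C j)" for j c
  have dec: "coeff3 T_op a b c = (\<Sum>j\<in>{..<r}. al j a * be j b * ga j c)" for a b c
    using coeff3_sum_tensor3[where J = "{..<r}" and A = A and B = B and C = C] assms
    by (simp add: al_def be_def ga_def)
  have nz0: "coeff3 T_op 1 3 0 \<noteq> 0"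
    by (simp add: coeff3_T_op)
  obtain j0 l ga' where "j0 \<in> {..<r}" and dec1:
    "\<And>a b c. coeff3 T_op a b c - l c * coeff3 T_op a b 0 = (\<Sum>j\<in>{..<r} - {j0}. al j a * be j b * ga' j c)"
    by (rule substitution_third_factor[where t = "coeff3 T_op", OF finite_lessThan dec nz0]) blast
  \<comment> \<open>swapping the last two arguments lets the same lemma substitute in the second factor\<close>
  define t1 where "t1 a c b = coeff3 T_op a b c - l c * coeff3 T_op a b 0" for a c b
  have nz1: "t1 2 1 0 \<noteq> 0"
    by (simp add: t1_def coeff3_T_op)
  have dec1': "t1 a c b = (\<Sum>j\<in>{..<r} - {j0}. al j a * ga' j c * be j b)" for a c b
    by (simp add: t1_def dec1 mult_ac)
  obtain j1 m be' where "j1 \<in> {..<r} - {j0}" and dec2: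
    "\<And>a c b. t1 a c b - m b * t1 a c 0 = (\<Sum>j\<in>{..<r} - {j0} - {j1}. al j a * ga' j c * be' j b)"
    by (rule substitution_third_factor[where t = t1, OF finite_Diff[OF finite_lessThan] dec1' nz1]) blast
  have residual: "T_op_residual l m (y + 1) (x + 1) (z + 1) =
      (\<Sum>j\<in>{..<r} - {j0} - {j1}. be' j (x + 1) * al j (y + 1) * ga' j (z + 1))" for x y z
    using dec2[of "y + 1" "z + 1" "x + 1"] by (simp add: T_op_residual_def t1_def algebra_simps)
  have "CARD(7) \<le> 2 * card ({..<r} - {j0} - {j1})"
    by (rule surj_koszul_flattening_card_le[OF _ residual T_op_residual_koszul_surj]) simp
  moreover have "card ({..<r} - {j0} - {j1}) = r - 2"
    using \<open>j0 \<in> {..<r}\<close> \<open>j1 \<in> {..<r} - {j0}\<close> by (simp add: card_Diff_singleton)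
  ultimately show ?thesis
    by simp
qed

lemma exhaust_12:
  fixes i :: 12
  shows "i = 0 \<or> i = 1 \<or> i = 2 \<or> i = 3 \<or> i = 4 \<or> i = 5 \<or> i = 6 \<or> i = 7 \<or> i = 8 \<or> i = 9
    \<or> i = 10 \<or> i = 11"
proof (induct i)
  case (of_int z)
  then have "z = 0 \<or> z = 1 \<or> z = 2 \<or> z = 3 \<or> z = 4 \<or> z = 5 \<or> z = 6 \<or> z = 7 \<or> z = 8 \<or> z = 9
      \<or> z = 10 \<or> z = 11"
    by simp presburger
  then show ?case by auto
qed

lemma sum_UNIV_12:
  "(\<Sum>i\<in>UNIV. f i) = f 0 + (f 1 + (f 2 + (f 3 + (f 4 + (f 5 + (f 6 + (f 7 + (f 8 + (f 9 + (f 10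
     + (f (11::12) :: 'a::comm_monoid_add)))))))))))"
proof -
  have univ: "(UNIV :: 12 set) = set [0, 1, 2, 3, 4, 5, 6, 7, 8, 9, 10, 11]"
    using exhaust_12 by auto
  have "distinct [0, 1, 2, 3, 4, 5, 6, 7, 8, 9, 10, 11 :: 12]"
    by simp
  then show ?thesis
    unfolding univ sum.distinct_set_conv_list by simp
qed

(* The linear map C^4 \<rightarrow> C^3 sending S_3, S_1, S_2, S_0 to
  e_0, e_1, e_1, e_2. *)
definition compress :: "(nat \<Rightarrow> 'a::plus) \<Rightarrow> nat \<Rightarrow> 'a" where
  "compress v x = (if x = 0 then v 3 else if x = 1 then v 1 + v 2 else v 0)"

lemma compress_sum: "compress (\<lambda>a. \<Sum>j\<in>J. f j a) x = (\<Sum>j\<in>J. compress (f j) x)"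
  by (simp add: compress_def sum.distrib)

lemma compress_mult_right: "compress (\<lambda>a. v a * c) x = compress v x * (c :: 'a::semiring)"
  by (simp add: compress_def distrib_right)

definition U8_koszul_index :: "12 \<Rightarrow> nat \<times> nat" where
  "U8_koszul_index i = (if i = 0 then (0, 0) else if i = 1 then (0, 1) else if i = 2 then (0, 2)
     else if i = 3 then (0, 3) else if i = 4 then (1, 0) else if i = 5 then (1, 1) else if i = 6 then (1, 2)
     else if i = 7 then (1, 3) else if i = 8 then (2, 0) else if i = 9 then (2, 1) else if i = 10 then (2, 2)
     else (2, 3))"

lemma U8_koszul_index_simps:
  "U8_koszul_index 0 = (0, 0)" "U8_koszul_index 1 = (0, 1)" "U8_koszul_index 2 = (0, 2)"
  "U8_koszul_index 3 = (0, 3)" "U8_koszul_index 4 = (1, 0)" "U8_koszul_index 5 = (1, 1)"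
  "U8_koszul_index 6 = (1, 2)" "U8_koszul_index 7 = (1, 3)" "U8_koszul_index 8 = (2, 0)"
  "U8_koszul_index 9 = (2, 1)" "U8_koszul_index 10 = (2, 2)" "U8_koszul_index 11 = (2, 3)"
  by (simp_all add: U8_koszul_index_def)

lemma U8_compressed_koszul_surj:
  "surj ((*v) (koszul_flattening (\<lambda>x y z. compress (\<lambda>a. coeff3 U8 a y z) x) U8_koszul_index U8_koszul_index))"
proof (rule surjI)
  fix v :: "complex^12"
  define u :: "complex^12" where
    "u = (\<chi> c. if c = 0 then - v$4 else if c = 1 then - v$6 else if c = 2 then - v$2 else if c = 3 then - v$0
      else if c = 4 then v$7 - v$8 else if c = 5 then v$5 - v$10 else if c = 6 then v$1 - v$4
      else if c = 7 then v$3 - v$6 else if c = 8 then v$9 else if c = 9 then v$11 else if c = 10 then v$5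
      else v$7)"
  have u: "u$0 = - v$4" "u$1 = - v$6" "u$2 = - v$2" "u$3 = - v$0" "u$4 = v$7 - v$8" "u$5 = v$5 - v$10"
    "u$6 = v$1 - v$4" "u$7 = v$3 - v$6" "u$8 = v$9" "u$9 = v$11" "u$10 = v$5" "u$11 = v$7"
    by (simp_all add: u_def)
  have "(koszul_flattening (\<lambda>x y z. compress (\<lambda>a. coeff3 U8 a y z) x) U8_koszul_index U8_koszul_index *v u)$i
          = v$i" for i
    using exhaust_12[of i]
    by (elim disjE) (simp only: matrix_vector_mult_def koszul_flattening_def vec_lambda_beta sum_UNIV_12
        sum_lessThan_3 U8_koszul_index_simps fst_conv snd_conv u;
        simp add: wedge_coeff_def compress_def coeff3_U8 algebra_simps)+
  then show "koszul_flattening (\<lambda>x y z. compress (\<lambda>a. coeff3 U8 a y z) x) U8_koszul_index U8_koszul_index *v u = v"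
    by (simp add: vec_eq_iff)
qed

lemma U8_rank_lower:
  fixes A B C :: "nat \<Rightarrow> mat2" and r :: nat
  assumes "U8 = (\<Sum>j<r. tensor3 (A j) (B j) (C j))"
  shows "6 \<le> r"
proof -
  have dec: "compress (\<lambda>a. coeff3 U8 a y z) x =
          (\<Sum>j\<in>{..<r}. compress (\<lambda>a. unit_coeff a (A j)) x * unit_coeff y (B j) * unit_coeff z (C j))" for x y z
    using coeff3_sum_tensor3[where J = "{..<r}" and A = A and B = B and C = C] assms
    by (simp add: compress_sum mult.assoc compress_mult_right)
  have "CARD(12) \<le> 2 * card {..<r}"
    by (rule surj_koszul_flattening_card_le[OF finite_lessThan _ U8_compressed_koszul_surj]) (rule dec)
  then show ?thesis
    by simp
qed

lemma T_op_decomposition: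
  "T_op = (\<Sum>j<6. tensor3 ([S1, S2, S3, S1, S2, S3] ! j) ([S3, S0, S2, S2, S1, S3] ! j)
                           ([S0, S1, S1, S2, S3, S3] ! j))"
  by (simp add: T_op_def numeral_eq_Suc lessThan_Suc add_ac)

lemma U8_decomposition:
  "U8 = (\<Sum>j<8. tensor3 ([S0, S1, S2, S3, S0, S1, S2, S3] ! j) ([S0, S3, S0, S2, S1, S2, S1, S3] ! j)
                         ([S0, S0, S1, S1, S2, S2, S3, S3] ! j))"
  by (simp add: U8_def numeral_eq_Suc lessThan_Suc add_ac)

theorem lemma4:
  shows "schmidt_rank T_op = 6 \<and> schmidt_rank U8 \<ge> 6"
proof
  obtain A B C where "T_op = (\<Sum>j<schmidt_rank T_op. tensor3 (A j) (B j) (C j))"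
    using schmidt_rank_attained[OF T_op_decomposition] .
  then have "6 \<le> schmidt_rank T_op"
    by (rule T_op_rank_lower)
  moreover have "schmidt_rank T_op \<le> 6"
    by (rule schmidt_rank_le[OF T_op_decomposition])
  ultimately show "schmidt_rank T_op = 6"
    by simp
next
  obtain A B C where "U8 = (\<Sum>j<schmidt_rank U8. tensor3 (A j) (B j) (C j))"
    using schmidt_rank_attained[OF U8_decomposition] .
  then show "schmidt_rank U8 \<ge> 6"
    by (rule U8_rank_lower)
qed

end
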